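(* If $G$ is a locally finite group having a fully characteristic finite index simple subgroup $H$, then $\operatorname{AT}(G)$ holds; that is, for every $\phi\in\operatorname{End}(G)$ and every $\phi$-invariant normal subgroup $N$ of $G$, $h(\phi)=h(\phi\upharpoonright_N)+h(\bar\phi_{G/N})$, where $\bar\phi_{G/N}\in\operatorname{End}(G/N)$ is the endomorphism induced by $\phi$.
   Context: A group is locally finite if every finitely generated subgroup is finite. A subgroup $H$ of $G$ is $\phi$-invariant (for $\phi\in\operatorname{End}(G)$) if $\phi(H)\subseteq H$, and fully characteristic if it is $\phi$-invariant for every $\phi\in\operatorname{End}(G)$. $\phi\upharpoonright_N$ denotes the restriction of $\phi$ to $N$. Algebraic entropy: let $G$ be a (not necessarily abelian) group and $\phi\in\operatorname{End}(G)$. For a nonempty finite subset $X$ of $G$ and a positive integer $n$, the $n$-th $\phi$-trajectory of $X$ is $T_n(\phi,X)=X\cdot\phi(X)\cdots\phi^{n-1}(X)$ (product of subsets). Put $H(\phi,X)=\lim_{n\to\infty}\frac{\log|T_n(\phi,X)|}{n}$ (the limit exists), and $h(\phi)=\sup\{H(\phi,X): X \text{ a nonempty finite subset of } G\}\in[0,\infty]$. *)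

theory Defs
  imports "HOL-Algebra.Generated_Groups" "HOL-Library.Extended_Real"
begin

definition locally_finite_group :: "('a, 'b) monoid_scheme \<Rightarrow> bool" where
  "locally_finite_group G \<longleftrightarrow>
     group G \<and> (\<forall>X. finite X \<and> X \<subseteq> carrier G \<longrightarrow> finite (generate G X))"

definition fully_characteristic :: "'a set \<Rightarrow> ('a, 'b) monoid_scheme \<Rightarrow> bool" where
  "fully_characteristic H G \<longleftrightarrow> subgroup H G \<and> (\<forall>\<phi>\<in>hom G G. \<phi> ` H \<subseteq> H)"

definition finite_index :: "'a set \<Rightarrow> ('a, 'b) monoid_scheme \<Rightarrow> bool" where
  "finite_index H G \<longleftrightarrow> finite (rcosets\<^bsub>G\<^esub> H)"

text \<open>The locale \<open>simple_group\<close> of HOL-Algebra requires \<open>order G > 1\<close>, which fails for infinite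
  groups because \<open>card\<close> of an infinite set is 0.  Here infinite simple groups must be allowed.\<close>

definition simple_grp :: "('a, 'b) monoid_scheme \<Rightarrow> bool" where
  "simple_grp G \<longleftrightarrow> group G \<and> carrier G \<noteq> {\<one>\<^bsub>G\<^esub>} \<and>
     (\<forall>N. N \<lhd> G \<longrightarrow> N = carrier G \<or> N = {\<one>\<^bsub>G\<^esub>})"

text \<open>The product \<open>X \<cdot> \<phi>(X) \<cdots> \<phi>^(n-1)(X)\<close>, with the empty product \<open>{\<one>}\<close> for \<open>n = 0\<close>.\<close>

primrec trajectory ::
    "('a, 'b) monoid_scheme \<Rightarrow> ('a \<Rightarrow> 'a) \<Rightarrow> 'a set \<Rightarrow> nat \<Rightarrow> 'a set" where
  "trajectory G \<phi> X 0 = {\<one>\<^bsub>G\<^esub>}"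
| "trajectory G \<phi> X (Suc n) = trajectory G \<phi> X n <#>\<^bsub>G\<^esub> (\<phi> ^^ n) ` X"

text \<open>For an endomorphism \<open>\<phi>\<close> and a nonempty finite \<open>X \<subseteq> carrier G\<close> the limit exists and is finite,
  since \<open>n \<mapsto> ln |T\<^sub>n(\<phi>, X)|\<close> is subadditive.\<close>

definition entropy_wrt :: "('a, 'b) monoid_scheme \<Rightarrow> ('a \<Rightarrow> 'a) \<Rightarrow> 'a set \<Rightarrow> real" where
  "entropy_wrt G \<phi> X = lim (\<lambda>n. ln (real (card (trajectory G \<phi> X n))) / real n)"

definition algebraic_entropy :: "('a, 'b) monoid_scheme \<Rightarrow> ('a \<Rightarrow> 'a) \<Rightarrow> ereal" where
  "algebraic_entropy G \<phi> =
     (SUP X \<in> {X. X \<subseteq> carrier G \<and> finite X \<and> X \<noteq> {}}. ereal (entropy_wrt G \<phi> X))"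

text \<open>The induced map on cosets, \<open>N x \<mapsto> N \<phi>(x)\<close>.  When \<open>\<phi>\<close> leaves \<open>N\<close> invariant, all members
  of the union coincide, so no representative has to be chosen.\<close>

definition induced_quotient_map ::
    "('a, 'b) monoid_scheme \<Rightarrow> 'a set \<Rightarrow> ('a \<Rightarrow> 'a) \<Rightarrow> 'a set \<Rightarrow> 'a set" where
  "induced_quotient_map G N \<phi> C = (\<Union>x\<in>C. N #>\<^bsub>G\<^esub> \<phi> x)"

lemma induced_quotient_map_coset:
  assumes "N \<lhd> G" "\<phi> \<in> hom G G" "\<phi> ` N \<subseteq> N" "x \<in> carrier G"
  shows "induced_quotient_map G N \<phi> (N #>\<^bsub>G\<^esub> x) = N #>\<^bsub>G\<^esub> \<phi> x"
proof -
  interpret N: normal N G by fact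
  have mem: "\<phi> x \<in> carrier G"
    using assms(2,4) by (rule hom_in_carrier)
  have "N #>\<^bsub>G\<^esub> \<phi> y = N #>\<^bsub>G\<^esub> \<phi> x" if y: "y \<in> N #>\<^bsub>G\<^esub> x" for y
  proof -
    obtain m where m: "m \<in> N" "y = m \<otimes>\<^bsub>G\<^esub> x"
      using y by (auto simp: r_coset_def)
    then have "\<phi> y = \<phi> m \<otimes>\<^bsub>G\<^esub> \<phi> x"
      using assms(2,4) N.subset by (auto simp: hom_def)
    moreover have "\<phi> m \<in> N" using m assms(3) by auto
    ultimately have "\<phi> y \<in> N #>\<^bsub>G\<^esub> \<phi> x" by (auto simp: r_coset_def)
    then show ?thesis
      using N.repr_independence[OF _ mem N.subgroup_axioms] by simp
  qed
  moreover have "x \<in> N #>\<^bsub>G\<^esub> x"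
    using assms(4) N.rcos_self[OF _ N.subgroup_axioms] by simp
  ultimately show ?thesis
    unfolding induced_quotient_map_def by blast
qed

definition addition_theorem :: "('a, 'b) monoid_scheme \<Rightarrow> bool" where
  "addition_theorem G \<longleftrightarrow>
     (\<forall>\<phi>\<in>hom G G. \<forall>N. N \<lhd> G \<and> \<phi> ` N \<subseteq> N \<longrightarrow>
        algebraic_entropy G \<phi> =
          algebraic_entropy (G\<lparr>carrier := N\<rparr>) (restrict \<phi> N) +
          algebraic_entropy (G Mod N) (induced_quotient_map G N \<phi>))"

end

(* By simplicity of H, a normal subgroup N either contains H, and then has finite index, or meets H
   trivially, and then embeds into the finite set of cosets of H.  If N is finite, passing to the
   quotient by N changes the size of a trajectory by a factor of at most |N|, so both entropies agree.
   If N has finite index, choose k such that every coset N \<phi>^k(g) is already of the form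
   N \<phi>^(k+1)(t) with t in a finite set T \<ni> 1, and put S = \<phi>^k(T).  For x \<in> \<phi>^k(X) and s \<in> S one can then
   write s x = h \<phi>(s') with s' \<in> S and with h in a finite subset L of N.  Applying this from left to
   right shifts the representative past the last factor of a trajectory, so that
   T_n(\<phi>, \<phi>^k(X)) is contained in T_n(\<phi>, L) \<phi>^n(S), and \<phi> and its restriction to N have equal entropy. *)
theory Submission
  imports Defs
begin

section \<open>Subadditive sequences\<close>

text \<open>Fekete's lemma: the limit is the infimum of the quotients with \<open>n \<ge> 1\<close>.
  Division with remainder, \<open>n = q * m + r\<close>, compares \<open>a n\<close> with
  \<open>q\<close> copies of \<open>a m\<close> and one of finitely many values
  \<open>a r\<close>.\<close>

lemma fekete_convergent:
  fixes a :: "nat \<Rightarrow> real"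
  assumes subadd: "\<And>m n. a (m + n) \<le> a m + a n" and nonneg: "\<And>n. 0 \<le> a n"
  shows "convergent (\<lambda>n. a n / real n)"
proof -
  define A where "A = (\<lambda>n. a n / real n) ` {1..}"
  define L where "L = Inf A"
  have bdd: "bdd_below A"
    by (rule bdd_belowI[of _ 0]) (auto simp: A_def nonneg)
  have mult: "a (q * m + r) \<le> real q * a m + a r" for q m r
  proof (induction q)
    case (Suc q)
    have "a (Suc q * m + r) \<le> a m + a (q * m + r)"
      using subadd[of m "q * m + r"] by (simp add: add.assoc)
    with Suc show ?case by (simp add: algebra_simps)
  qed simp
  have "(\<lambda>n. a n / real n) \<longlonglongrightarrow> L"
  proof (rule order_tendstoI)
    fix y assume "y < L"
    have "y < a n / real n" if "n \<ge> 1" for n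
      using \<open>y < L\<close> cInf_lower[OF _ bdd, of "a n / real n"] that by (force simp: A_def L_def)
    then show "\<forall>\<^sub>F n in sequentially. y < a n / real n"
      using eventually_sequentially by blast
  next
    fix y assume "L < y"
    then obtain m where m: "m \<ge> 1" "a m / real m < y"
      using cInf_lessD[of A y] by (auto simp: A_def L_def)
    \<comment> \<open>The quotient at \<open>m\<close> is already below \<open>y\<close>. All
      remainders modulo \<open>m\<close> cost at most the constant \<open>M\<close>, which
      disappears after division by \<open>n\<close>.\<close>
    define M where "M = Max (a ` {..<m})"
    have "(\<lambda>n. a m / real m + M / real n) \<longlonglongrightarrow> a m / real m + 0"
      by (intro tendsto_intros lim_const_over_n)
    then have "\<forall>\<^sub>F n in sequentially. a m / real m + M / real n < y"
      using m(2) by (intro order_tendstoD(2)) auto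
    moreover have "\<forall>\<^sub>F n in sequentially. n \<ge> 1"
      by (rule eventually_ge_at_top)
    ultimately show "\<forall>\<^sub>F n in sequentially. a n / real n < y"
    proof eventually_elim
      case (elim n)
      have "a (n mod m) \<le> M"
        unfolding M_def using m(1) by (intro Max_ge) auto
      \<comment> \<open>Nonnegativity of \<open>a m\<close> allows the integer quotient to be
        replaced by the real one.\<close>
      moreover have "real (n div m) * a m \<le> real n / real m * a m"
        by (intro mult_right_mono nonneg of_nat_div_le_of_nat)
      ultimately have "a n \<le> real n / real m * a m + M"
        using mult[of "n div m" m "n mod m"] by simp
      then have "a n / real n \<le> a m / real m + M / real n"
        using elim(2) m(1) by (simp add: field_simps)
      with elim(1) show ?case by simp
    qed
  qed
  then show ?thesis by (rule convergentI)
qed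

section \<open>Products of subsets\<close>

lemma finite_set_mult: "finite A \<Longrightarrow> finite B \<Longrightarrow> finite (A <#>\<^bsub>G\<^esub> B)"
  by (simp add: set_mult_def)

lemma card_set_mult_le:
  assumes "finite A" "finite B"
  shows "card (A <#>\<^bsub>G\<^esub> B) \<le> card A * card B"
proof -
  have "A <#>\<^bsub>G\<^esub> B = (\<lambda>(x, y). x \<otimes>\<^bsub>G\<^esub> y) ` (A \<times> B)"
    by (auto simp: set_mult_def)
  then show ?thesis
    using card_image_le[of "A \<times> B"] assms by (simp add: card_cartesian_product)
qed

lemma hom_image_set_mult:
  assumes "\<phi> \<in> hom G G'" "A \<subseteq> carrier G" "B \<subseteq> carrier G"
  shows "\<phi> ` (A <#>\<^bsub>G\<^esub> B) = \<phi> ` A <#>\<^bsub>G'\<^esub> \<phi> ` B"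
proof -
  have "\<phi> (a \<otimes>\<^bsub>G\<^esub> b) = \<phi> a \<otimes>\<^bsub>G'\<^esub> \<phi> b" if "a \<in> A" "b \<in> B" for a b
    using that assms by (meson hom_mult subsetD)
  then show ?thesis
    by (simp add: set_mult_def image_UN)
qed

section \<open>Trajectories of an endomorphism and existence of the entropy limit\<close>

locale group_endomorphism = group G for G (structure) +
  fixes \<phi> :: "'a \<Rightarrow> 'a"
  assumes endo: "\<phi> \<in> hom G G"
begin

lemma funpow_hom: "\<phi> ^^ n \<in> hom G G"
proof (induction n)
  case (Suc n)
  then show ?case using Group.hom_compose[OF Suc endo] by (simp add: o_def)
qed (simp add: hom_def)

lemma funpow_closed [simp]: "x \<in> carrier G \<Longrightarrow> (\<phi> ^^ n) x \<in> carrier G"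
  by (rule hom_in_carrier[OF funpow_hom])

lemma funpow_mult [simp]:
  "x \<in> carrier G \<Longrightarrow> y \<in> carrier G \<Longrightarrow> (\<phi> ^^ n) (x \<otimes> y) = (\<phi> ^^ n) x \<otimes> (\<phi> ^^ n) y"
  by (rule hom_mult[OF funpow_hom])

lemma funpow_one [simp]: "(\<phi> ^^ n) \<one> = \<one>"
  using hom_one[OF funpow_hom is_group is_group] .

lemma trajectory_subset: "X \<subseteq> carrier G \<Longrightarrow> trajectory G \<phi> X n \<subseteq> carrier G"
proof (induction n)
  case (Suc n)
  moreover have "(\<phi> ^^ n) ` X \<subseteq> carrier G" using Suc.prems by auto
  ultimately show ?case by (simp add: set_mult_closed)
qed simp

lemma trajectory_finite: "finite X \<Longrightarrow> finite (trajectory G \<phi> X n)"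
  by (induction n) (auto intro: finite_set_mult)

lemma trajectory_nonempty: "X \<noteq> {} \<Longrightarrow> trajectory G \<phi> X n \<noteq> {}"
  by (induction n) (auto simp: set_mult_def)

lemma card_trajectory_pos: "finite X \<Longrightarrow> X \<noteq> {} \<Longrightarrow> 0 < card (trajectory G \<phi> X n)"
  by (simp add: card_gt_0_iff trajectory_finite trajectory_nonempty)

lemma funpow_image_trajectory:
  assumes "X \<subseteq> carrier G"
  shows "(\<phi> ^^ k) ` trajectory G \<phi> X n = trajectory G \<phi> ((\<phi> ^^ k) ` X) n"
proof (induction n)
  case (Suc n)
  have "(\<phi> ^^ n) ` X \<subseteq> carrier G" using assms by auto
  with Suc show ?case
    by (simp add: hom_image_set_mult[OF funpow_hom trajectory_subset[OF assms]]
        image_comp flip: funpow_add add.commute[of k])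
qed simp

lemma trajectory_add:
  assumes "X \<subseteq> carrier G"
  shows "trajectory G \<phi> X (m + n) = trajectory G \<phi> X m <#> (\<phi> ^^ m) ` trajectory G \<phi> X n"
proof (induction n)
  case 0
  show ?case
    using trajectory_subset[OF assms, of m] by (force simp: set_mult_def)
next
  case (Suc n)
  have sub: "(\<phi> ^^ i) ` X \<subseteq> carrier G" for i using assms by auto
  have "trajectory G \<phi> X (m + Suc n)
      = (trajectory G \<phi> X m <#> (\<phi> ^^ m) ` trajectory G \<phi> X n) <#> (\<phi> ^^ m) ` (\<phi> ^^ n) ` X"
    using Suc by (simp add: image_comp funpow_add)
  also have "\<dots> = trajectory G \<phi> X m <#> ((\<phi> ^^ m) ` trajectory G \<phi> X n <#> (\<phi> ^^ m) ` (\<phi> ^^ n) ` X)"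
    using assms trajectory_subset[OF assms]
    by (intro set_mult_assoc) (auto simp: image_subset_iff subset_iff)
  finally show ?case
    by (simp add: hom_image_set_mult[OF funpow_hom trajectory_subset[OF assms] sub])
qed

lemma card_trajectory_add_le:
  assumes "X \<subseteq> carrier G" "finite X"
  shows "card (trajectory G \<phi> X (m + n))
    \<le> card (trajectory G \<phi> X m) * card ((\<phi> ^^ m) ` trajectory G \<phi> X n)"
  using assms by (simp add: trajectory_add card_set_mult_le trajectory_finite)

text \<open>As \<open>X\<close> may omit \<open>\<one>\<close>, trajectories need not be nested.
  Right translation by \<open>(\<phi> ^^ n) x\<close> for a fixed \<open>x \<in> X\<close> is
  injective, though, and maps each trajectory into the next.\<close>

lemma card_trajectory_mono:
  assumes "X \<subseteq> carrier G" "finite X" "X \<noteq> {}" "m \<le> n"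
  shows "card (trajectory G \<phi> X m) \<le> card (trajectory G \<phi> X n)"
  using \<open>m \<le> n\<close>
proof (induction n rule: dec_induct)
  case (step n)
  obtain x where x: "x \<in> X" using \<open>X \<noteq> {}\<close> by blast
  have "card (trajectory G \<phi> X n) = card ((\<lambda>y. y \<otimes> (\<phi> ^^ n) x) ` trajectory G \<phi> X n)"
    using assms(1) x trajectory_subset[OF assms(1), of n]
    by (intro card_image[symmetric] inj_onI) (metis right_cancel funpow_closed subsetD)
  also have "\<dots> \<le> card (trajectory G \<phi> X (Suc n))"
    using x trajectory_finite[OF assms(2), of "Suc n"]
    by (intro card_mono) (auto simp: set_mult_def)
  finally show ?case using step.IH by simp
qed simp

text \<open>Logarithms of trajectory sizes are subadditive and nonnegative, so Fekete's lemma makes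
  the \<open>lim\<close> in the definition a genuine limit.\<close>

lemma entropy_wrt_tendsto:
  assumes "X \<subseteq> carrier G" "finite X" "X \<noteq> {}"
  shows "(\<lambda>n. ln (real (card (trajectory G \<phi> X n))) / real n) \<longlonglongrightarrow> entropy_wrt G \<phi> X"
proof -
  note pos = card_trajectory_pos[OF assms(2,3)]
  have "ln (real (card (trajectory G \<phi> X (m + n))))
      \<le> ln (real (card (trajectory G \<phi> X m))) + ln (real (card (trajectory G \<phi> X n)))" for m n
  proof -
    have "card (trajectory G \<phi> X (m + n)) \<le> card (trajectory G \<phi> X m) * card (trajectory G \<phi> X n)"
      using card_trajectory_add_le[OF assms(1,2), of m n]
        card_image_le[OF trajectory_finite[OF assms(2)], of "\<phi> ^^ m" n]
      by (meson le_trans mult_le_mono2)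
    then have "real (card (trajectory G \<phi> X (m + n)))
        \<le> real (card (trajectory G \<phi> X m)) * real (card (trajectory G \<phi> X n))"
      by (simp flip: of_nat_mult)
    then show ?thesis
      using pos by (simp flip: ln_mult_pos)
  qed
  moreover have "0 \<le> ln (real (card (trajectory G \<phi> X n)))" for n
    using pos[of n] by simp
  ultimately have "convergent (\<lambda>n. ln (real (card (trajectory G \<phi> X n))) / real n)"
    by (rule fekete_convergent)
  then show ?thesis
    unfolding entropy_wrt_def by (simp add: convergent_LIMSEQ_iff)
qed

lemma entropy_wrt_nonneg:
  assumes "X \<subseteq> carrier G" "finite X" "X \<noteq> {}"
  shows "0 \<le> entropy_wrt G \<phi> X"
proof (rule LIMSEQ_le_const[OF entropy_wrt_tendsto[OF assms]])
  show "\<exists>N. \<forall>n\<ge>N. 0 \<le> ln (real (card (trajectory G \<phi> X n))) / real n"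
    using card_trajectory_pos[OF assms(2,3)] by (auto simp: Suc_le_eq)
qed

lemma algebraic_entropy_nonneg: "0 \<le> algebraic_entropy G \<phi>"
  unfolding algebraic_entropy_def
  by (rule SUP_upper2[of "{\<one>}"]) (auto intro!: entropy_wrt_nonneg)

end

section \<open>Comparison of entropies\<close>

text \<open>A constant factor \<open>c\<close> contributes \<open>ln c / n\<close>, which tends to
  0. Writing lengths as \<open>k + n\<close> means that only lengths from \<open>k\<close> on have
  to be compared.\<close>

lemma entropy_wrt_le:
  assumes G: "group_endomorphism G \<phi>" "X \<subseteq> carrier G" "finite X" "X \<noteq> {}"
    and G': "group_endomorphism G' \<phi>'" "Y \<subseteq> carrier G'" "finite Y" "Y \<noteq> {}"
    and le: "\<And>n. card (trajectory G \<phi> X (k + n)) \<le> c * card (trajectory G' \<phi>' Y (k + n))"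
  shows "entropy_wrt G \<phi> X \<le> entropy_wrt G' \<phi>' Y"
proof -
  interpret G: group_endomorphism G \<phi> by fact
  interpret G': group_endomorphism G' \<phi>' by fact
  let ?a = "\<lambda>n. ln (real (card (trajectory G \<phi> X n)))"
  let ?b = "\<lambda>n. ln (real (card (trajectory G' \<phi>' Y n)))"
  have "?a n / real n \<le> ln (real c) / real n + ?b n / real n" if "n \<ge> k" for n
  proof -
    have le: "card (trajectory G \<phi> X n) \<le> c * card (trajectory G' \<phi>' Y n)"
      using le[of "n - k"] that by simp
    have pos: "0 < card (trajectory G \<phi> X n)" "0 < card (trajectory G' \<phi>' Y n)"
      using G.card_trajectory_pos G'.card_trajectory_pos assms by auto
    with le have "0 < c" by (metis gr0I le_zero_eq mult_0)
    have "real (card (trajectory G \<phi> X n)) \<le> real c * real (card (trajectory G' \<phi>' Y n))"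
      using le by (simp flip: of_nat_mult)
    then have "?a n \<le> ln (real c) + ?b n"
      using pos \<open>0 < c\<close> by (simp flip: ln_mult_pos)
    \<comment> \<open>Division by zero yields 0, so \<open>n = 0\<close> is covered as well.\<close>
    then show ?thesis
      by (simp add: divide_right_mono flip: add_divide_distrib)
  qed
  moreover have "(\<lambda>n. ln (real c) / real n + ?b n / real n) \<longlonglongrightarrow> 0 + entropy_wrt G' \<phi>' Y"
    using G' by (intro tendsto_add lim_const_over_n G'.entropy_wrt_tendsto)
  ultimately show ?thesis
    using LIMSEQ_le[OF G.entropy_wrt_tendsto[OF G(2-4)]] by (metis (no_types, lifting) add_0)
qed

lemma algebraic_entropy_leI:
  assumes "\<And>X. X \<subseteq> carrier G \<Longrightarrow> finite X \<Longrightarrow> X \<noteq> {} \<Longrightarrow>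
    \<exists>Y. Y \<subseteq> carrier G' \<and> finite Y \<and> Y \<noteq> {} \<and> entropy_wrt G \<phi> X \<le> entropy_wrt G' \<phi>' Y"
  shows "algebraic_entropy G \<phi> \<le> algebraic_entropy G' \<phi>'"
  unfolding algebraic_entropy_def
proof (rule SUP_mono)
  fix X assume "X \<in> {X. X \<subseteq> carrier G \<and> finite X \<and> X \<noteq> {}}"
  then have X: "X \<subseteq> carrier G" "finite X" "X \<noteq> {}" by simp_all
  obtain Y where "Y \<subseteq> carrier G'" "finite Y" "Y \<noteq> {}"
    "entropy_wrt G \<phi> X \<le> entropy_wrt G' \<phi>' Y"
    using assms[OF X] by (elim exE conjE)
  then show "\<exists>Y\<in>{X. X \<subseteq> carrier G' \<and> finite X \<and> X \<noteq> {}}.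
      ereal (entropy_wrt G \<phi> X) \<le> ereal (entropy_wrt G' \<phi>' Y)"
    by (intro bexI[of _ Y]) simp_all
qed

section \<open>Finite groups and restriction to an invariant subgroup\<close>

context group_endomorphism
begin

text \<open>Trajectory sizes stay below the order of the group, so their logarithms divided by
  \<open>n\<close> tend to 0.\<close>

lemma algebraic_entropy_finite:
  assumes "finite (carrier G)"
  shows "algebraic_entropy G \<phi> = 0"
proof -
  have "entropy_wrt G \<phi> X \<le> 0" if X: "X \<subseteq> carrier G" "finite X" "X \<noteq> {}" for X
  proof (rule LIMSEQ_le[OF entropy_wrt_tendsto[OF X] lim_const_over_n])
    have "ln (real (card (trajectory G \<phi> X n))) \<le> ln (real (card (carrier G)))" for n
    proof (rule ln_mono)
      show "real (card (trajectory G \<phi> X n)) \<le> real (card (carrier G))"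
        unfolding of_nat_le_iff using assms trajectory_subset[OF X(1)] by (rule card_mono)
      show "0 < real (card (trajectory G \<phi> X n))"
        unfolding of_nat_0_less_iff using X(2,3) by (rule card_trajectory_pos)
    qed
    then show "\<exists>N. \<forall>n\<ge>N. ln (real (card (trajectory G \<phi> X n))) / real n
        \<le> ln (real (card (carrier G))) / real n"
      by (simp add: divide_right_mono)
  qed
  then have "algebraic_entropy G \<phi> \<le> 0"
    unfolding algebraic_entropy_def by (intro SUP_least) (auto simp: zero_ereal_def)
  then show ?thesis
    using algebraic_entropy_nonneg by (rule antisym)
qed

lemma group_endomorphism_restrict:
  assumes "subgroup N G" "\<phi> ` N \<subseteq> N"
  shows "group_endomorphism (G\<lparr>carrier := N\<rparr>) (restrict \<phi> N)"
proof -
  interpret N: subgroup N G by fact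
  have "restrict \<phi> N \<in> hom (G\<lparr>carrier := N\<rparr>) (G\<lparr>carrier := N\<rparr>)"
    using assms(2) hom_mult[OF endo] N.subset by (auto simp: hom_def)
  then show ?thesis
    using N.subgroup_is_group[OF is_group]
    by (simp add: group_endomorphism_def group_endomorphism_axioms_def)
qed

lemma trajectory_restrict:
  assumes "\<phi> ` N \<subseteq> N" "X \<subseteq> N"
  shows "trajectory (G\<lparr>carrier := N\<rparr>) (restrict \<phi> N) X n = trajectory G \<phi> X n"
proof (induction n)
  case (Suc n)
  \<comment> \<open>Outside \<open>N\<close> the restricted map is \<open>undefined\<close>, so the
    induction must also carry that the iterates stay in \<open>N\<close>.\<close>
  have "(restrict \<phi> N ^^ n) x = (\<phi> ^^ n) x \<and> (\<phi> ^^ n) x \<in> N" if "x \<in> N" for x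
    using that assms(1) by (induction n) auto
  then have "(restrict \<phi> N ^^ n) ` X = (\<phi> ^^ n) ` X"
    using assms(2) by (intro image_cong) auto
  moreover have "A <#>\<^bsub>G\<lparr>carrier := N\<rparr>\<^esub> B = A <#> B" for A B
    by (simp add: set_mult_def)
  ultimately show ?case
    by (simp only: trajectory.simps Suc)
qed simp

lemma entropy_wrt_restrict:
  assumes "\<phi> ` N \<subseteq> N" "X \<subseteq> N"
  shows "entropy_wrt (G\<lparr>carrier := N\<rparr>) (restrict \<phi> N) X = entropy_wrt G \<phi> X"
  by (simp add: entropy_wrt_def trajectory_restrict[OF assms])

lemma algebraic_entropy_restrict_le:
  assumes "subgroup N G" "\<phi> ` N \<subseteq> N"
  shows "algebraic_entropy (G\<lparr>carrier := N\<rparr>) (restrict \<phi> N) \<le> algebraic_entropy G \<phi>"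
proof (rule algebraic_entropy_leI)
  fix X assume X: "X \<subseteq> carrier (G\<lparr>carrier := N\<rparr>)" "finite X" "X \<noteq> {}"
  then have "X \<subseteq> N" by simp
  then have "X \<subseteq> carrier G"
    using subgroup.subset[OF assms(1)] by (rule order_trans)
  moreover have "entropy_wrt (G\<lparr>carrier := N\<rparr>) (restrict \<phi> N) X \<le> entropy_wrt G \<phi> X"
    by (rule eq_refl, rule entropy_wrt_restrict[OF assms(2) \<open>X \<subseteq> N\<close>])
  ultimately show "\<exists>Y\<subseteq>carrier G. finite Y \<and> Y \<noteq> {} \<and>
      entropy_wrt (G\<lparr>carrier := N\<rparr>) (restrict \<phi> N) X \<le> entropy_wrt G \<phi> Y"
    using X(2,3) by (intro exI[of _ X] conjI)
qed

section \<open>Invariant subgroups of finite index\<close>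

text \<open>One representative \<open>s\<close> is carried at the right end. Appending
  \<open>(\<phi> ^^ n) p\<close> produces \<open>(\<phi> ^^ n) (s \<otimes> p)\<close>, which equals
  \<open>(\<phi> ^^ n) h \<otimes> (\<phi> ^^ Suc n) s'\<close>: here \<open>h\<close> extends the
  trajectory of \<open>L\<close>, and \<open>s'\<close> waits for the next factor.\<close>

lemma trajectory_subset_transversal:
  assumes carr: "P \<subseteq> carrier G" "S \<subseteq> carrier G" "L \<subseteq> carrier G"
    and "\<one> \<in> S"
    and shift: "\<And>s p. s \<in> S \<Longrightarrow> p \<in> P \<Longrightarrow> \<exists>h\<in>L. \<exists>s'\<in>S. s \<otimes> p = h \<otimes> \<phi> s'"
  shows "trajectory G \<phi> P n \<subseteq> trajectory G \<phi> L n <#> (\<phi> ^^ n) ` S"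
proof (induction n)
  case 0
  \<comment> \<open>The empty product starts with the representative \<open>\<one>\<close>.\<close>
  show ?case using \<open>\<one> \<in> S\<close> by (auto simp: set_mult_def intro!: bexI[of _ \<one>])
next
  case (Suc n)
  show ?case
  proof
    fix v assume "v \<in> trajectory G \<phi> P (Suc n)"
    then obtain u p where p: "p \<in> P" "u \<in> trajectory G \<phi> P n" and v: "v = u \<otimes> (\<phi> ^^ n) p"
      by (auto simp: set_mult_def)
    then obtain l s where ls: "l \<in> trajectory G \<phi> L n" "s \<in> S" "u = l \<otimes> (\<phi> ^^ n) s"
      using Suc by (fastforce simp: set_mult_def)
    obtain h s' where h: "h \<in> L" "s' \<in> S" "s \<otimes> p = h \<otimes> \<phi> s'"
      using shift ls(2) p(1) by blast
    have l: "l \<in> carrier G" using ls(1) trajectory_subset[OF carr(3)] by blast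
    have in_carr: "p \<in> carrier G" "s \<in> carrier G" "s' \<in> carrier G" "h \<in> carrier G"
      using p(1) ls(2) h carr by auto
    then have \<phi>s': "\<phi> s' \<in> carrier G" using funpow_closed[of s' 1] by simp
    have "v = l \<otimes> (\<phi> ^^ n) (s \<otimes> p)"
      using in_carr l by (simp add: v ls(3) m_assoc)
    also have "\<dots> = (l \<otimes> (\<phi> ^^ n) h) \<otimes> (\<phi> ^^ Suc n) s'"
      using in_carr l \<phi>s' by (simp add: h(3) m_assoc funpow_swap1)
    finally show "v \<in> trajectory G \<phi> L (Suc n) <#> (\<phi> ^^ Suc n) ` S"
      using ls(1) h(1,2) by (auto simp: set_mult_def simp del: funpow.simps)
  qed
qed

text \<open>The cosets of \<open>N\<close> met by the image of \<open>\<phi> ^^ k\<close> form a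
  decreasing chain of finite sets, which must become stationary. \<open>T\<close> lists
  representatives, possibly with repetitions.\<close>

lemma finite_index_stable_transversal:
  assumes "finite_index N G"
  obtains k T where "finite T" "T \<subseteq> carrier G" "\<one> \<in> T"
    "\<And>g. g \<in> carrier G \<Longrightarrow> \<exists>t\<in>T. N #> (\<phi> ^^ k) g = N #> (\<phi> ^^ Suc k) t"
proof -
  define A where "A k = (\<lambda>x. N #> (\<phi> ^^ k) x) ` carrier G" for k
  have "A k \<subseteq> rcosets N" for k
    unfolding A_def RCOSETS_def using funpow_closed by blast
  then have fin: "finite (A k)" for k
    using assms finite_subset unfolding finite_index_def by metis
  \<comment> \<open>At a \<open>k\<close> of least cardinality the next set, being contained in this
    one, has to coincide with it.\<close>
  obtain k where k: "\<And>j. card (A k) \<le> card (A j)"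
    using ex_has_least_nat[of "\<lambda>_. True" 0 "\<lambda>j. card (A j)"] by auto
  have "A (Suc k) \<subseteq> A k"
    unfolding A_def funpow_Suc_right o_apply
    using hom_in_carrier[OF endo] by (intro image_subsetI imageI)
  then have "A (Suc k) = A k"
    by (rule card_seteq[OF fin _ k])
  have "A (Suc k) \<subseteq> (\<lambda>x. N #> (\<phi> ^^ Suc k) x) ` carrier G"
    by (simp only: A_def order_refl)
  then obtain T where T: "T \<subseteq> carrier G" "finite T" "A (Suc k) = (\<lambda>x. N #> (\<phi> ^^ Suc k) x) ` T"
    using finite_subset_image[OF fin] by metis
  \<comment> \<open>Adding \<open>\<one>\<close> supplies the initial representative for the
    shifting argument.\<close>
  have "\<exists>t\<in>insert \<one> T. N #> (\<phi> ^^ k) g = N #> (\<phi> ^^ Suc k) t" if "g \<in> carrier G" for g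
  proof -
    have "N #> (\<phi> ^^ k) g \<in> A (Suc k)"
      unfolding \<open>A (Suc k) = A k\<close> unfolding A_def using that by (rule imageI)
    then show ?thesis unfolding T(3) by blast
  qed
  with T(1,2) show thesis
    by (intro that[of "insert \<one> T" k]) simp_all
qed

lemma algebraic_entropy_finite_index:
  assumes N: "subgroup N G" "finite_index N G" "\<phi> ` N \<subseteq> N"
  shows "algebraic_entropy (G\<lparr>carrier := N\<rparr>) (restrict \<phi> N) = algebraic_entropy G \<phi>"
proof (rule antisym[OF algebraic_entropy_restrict_le[OF N(1,3)]], rule algebraic_entropy_leI)
  interpret N: subgroup N G by (rule N)
  fix X assume X: "X \<subseteq> carrier G" "finite X" "X \<noteq> {}"
  obtain k T where T: "finite T" "T \<subseteq> carrier G" "\<one> \<in> T"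
    and stable: "\<And>g. g \<in> carrier G \<Longrightarrow> \<exists>t\<in>T. N #> (\<phi> ^^ k) g = N #> (\<phi> ^^ Suc k) t"
    by (rule finite_index_stable_transversal[OF N(2)]) (rule that)
  define S where "S = (\<phi> ^^ k) ` T"
  define P where "P = (\<phi> ^^ k) ` X"
  \<comment> \<open>\<open>L\<close> gathers every element of \<open>N\<close> that can arise when a
    representative is shifted past an element of \<open>P\<close>.\<close>
  define L where "L = {h \<in> N. \<exists>s\<in>S. \<exists>p\<in>P. \<exists>s'\<in>S. s \<otimes> p = h \<otimes> \<phi> s'}"
  have S: "finite S" "S \<subseteq> carrier G" "\<one> \<in> S"
    using T by (auto simp: S_def image_iff intro: bexI[of _ \<one>])
  have P: "finite P" "P \<subseteq> carrier G" "P \<noteq> {}"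
    using X by (auto simp: P_def)
  have \<phi>_closed: "\<phi> x \<in> carrier G" if "x \<in> carrier G" for x
    using funpow_closed[OF that, of 1] by simp
  have shift: "\<exists>h\<in>L. \<exists>s'\<in>S. s \<otimes> p = h \<otimes> \<phi> s'" if sp: "s \<in> S" "p \<in> P" for s p
  proof -
    obtain t x where tx: "t \<in> T" "s = (\<phi> ^^ k) t" "x \<in> X" "p = (\<phi> ^^ k) x"
      using sp by (auto simp: S_def P_def)
    then have "t \<in> carrier G" "x \<in> carrier G" using T(2) X(1) by auto
    \<comment> \<open>Since \<open>s\<close> and \<open>p\<close> both lie in the image of
      \<open>\<phi> ^^ k\<close>, so does their product, and stability applies to it. This is why
      \<open>X\<close> is replaced by \<open>P\<close>.\<close>
    then have g: "t \<otimes> x \<in> carrier G" "s \<otimes> p = (\<phi> ^^ k) (t \<otimes> x)"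
      by (simp_all add: tx(2,4))
    obtain t' where t': "t' \<in> T" "N #> (\<phi> ^^ k) (t \<otimes> x) = N #> (\<phi> ^^ Suc k) t'"
      using stable[OF g(1)] by blast
    have "s \<otimes> p \<in> N #> (\<phi> ^^ Suc k) t'"
      using rcos_self[OF funpow_closed[OF g(1)] N(1), of k] by (simp only: g(2) t'(2))
    then obtain h where "h \<in> N" "s \<otimes> p = h \<otimes> \<phi> ((\<phi> ^^ k) t')"
      by (auto simp: r_coset_def)
    moreover have "(\<phi> ^^ k) t' \<in> S"
      unfolding S_def using t'(1) by (rule imageI)
    ultimately show ?thesis
      unfolding L_def using sp by blast
  qed
  \<comment> \<open>Solving the equation for \<open>h\<close> shows that it is determined by a
    triple from a finite set.\<close>
  have "L \<subseteq> (\<lambda>(s, p, s'). s \<otimes> p \<otimes> inv (\<phi> s')) ` (S \<times> P \<times> S)"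
  proof
    fix h assume "h \<in> L"
    then obtain s p s' where *: "h \<in> N" "s \<in> S" "p \<in> P" "s' \<in> S" "s \<otimes> p = h \<otimes> \<phi> s'"
      by (auto simp: L_def)
    moreover have "h \<in> carrier G" "\<phi> s' \<in> carrier G"
      using * S(2) N.subset \<phi>_closed by auto
    ultimately have "h = s \<otimes> p \<otimes> inv (\<phi> s')"
      by (simp add: m_assoc)
    with * show "h \<in> (\<lambda>(s, p, s'). s \<otimes> p \<otimes> inv (\<phi> s')) ` (S \<times> P \<times> S)"
      by force
  qed
  then have "finite L"
    by (rule finite_subset) (simp add: S P)
  have "L \<subseteq> N" by (auto simp: L_def)
  obtain p where "p \<in> P" using P(3) by blast
  then have "L \<noteq> {}" using shift[OF S(3)] by blast
  have "L \<subseteq> carrier G" using \<open>L \<subseteq> N\<close> N.subset by (rule order_trans)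
  have "entropy_wrt G \<phi> X \<le> entropy_wrt G \<phi> L"
  proof (rule entropy_wrt_le)
    show "group_endomorphism G \<phi>" "group_endomorphism G \<phi>"
      by (fact group_endomorphism_axioms)+
    \<comment> \<open>The first \<open>k\<close> factors of the trajectory of \<open>X\<close> cost
      at most \<open>card (trajectory G \<phi> X k)\<close>; the remaining ones form a trajectory of
      \<open>P\<close>, whose final representative costs at most \<open>card S\<close>.\<close>
    show "card (trajectory G \<phi> X (k + n))
        \<le> (card (trajectory G \<phi> X k) * card S) * card (trajectory G \<phi> L (k + n))" for n
    proof -
      have "card (trajectory G \<phi> P n) \<le> card (trajectory G \<phi> L n <#> (\<phi> ^^ n) ` S)"
        using trajectory_subset_transversal[OF P(2) S(2) \<open>L \<subseteq> carrier G\<close> S(3) shift]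
        by (intro card_mono finite_set_mult trajectory_finite finite_imageI \<open>finite L\<close> S)
      also have "\<dots> \<le> card (trajectory G \<phi> L n) * card ((\<phi> ^^ n) ` S)"
        by (intro card_set_mult_le trajectory_finite finite_imageI \<open>finite L\<close> S)
      \<comment> \<open>Monotonicity lengthens the trajectory of \<open>L\<close> so that both sides
        have length \<open>k + n\<close>.\<close>
      also have "\<dots> \<le> card (trajectory G \<phi> L (k + n)) * card S"
        using \<open>L \<subseteq> carrier G\<close> \<open>finite L\<close> \<open>L \<noteq> {}\<close> S(1)
        by (intro mult_le_mono card_trajectory_mono card_image_le) auto
      finally have "card (trajectory G \<phi> P n) \<le> card (trajectory G \<phi> L (k + n)) * card S" .
      then have "card (trajectory G \<phi> X k) * card (trajectory G \<phi> P n)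
          \<le> (card (trajectory G \<phi> X k) * card S) * card (trajectory G \<phi> L (k + n))"
        using mult_le_mono2 by (metis mult.assoc mult.commute)
      moreover have "card (trajectory G \<phi> X (k + n))
          \<le> card (trajectory G \<phi> X k) * card (trajectory G \<phi> P n)"
        using card_trajectory_add_le[OF X(1,2), of k n]
        by (simp only: P_def funpow_image_trajectory[OF X(1)])
      ultimately show ?thesis by (rule le_trans[rotated])
    qed
  qed (fact X \<open>finite L\<close> \<open>L \<noteq> {}\<close> \<open>L \<subseteq> carrier G\<close>)+
  then show "\<exists>Y\<subseteq>carrier (G\<lparr>carrier := N\<rparr>). finite Y \<and> Y \<noteq> {} \<and>
      entropy_wrt G \<phi> X \<le> entropy_wrt (G\<lparr>carrier := N\<rparr>) (restrict \<phi> N) Y"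
    using \<open>finite L\<close> \<open>L \<noteq> {}\<close> \<open>L \<subseteq> N\<close> entropy_wrt_restrict[OF N(3) \<open>L \<subseteq> N\<close>]
    by (intro exI[of _ L]) simp
qed

section \<open>Quotients and finite normal subgroups\<close>

lemma group_endomorphism_quotient:
  assumes "N \<lhd> G" "\<phi> ` N \<subseteq> N"
  shows "group_endomorphism (G Mod N) (induced_quotient_map G N \<phi>)"
proof -
  interpret N: normal N G by fact
  note coset = induced_quotient_map_coset[OF assms(1) endo assms(2)]
  have closed: "\<phi> x \<in> carrier G" if "x \<in> carrier G" for x
    using endo that by (rule hom_in_carrier)
  have "induced_quotient_map G N \<phi> \<in> hom (G Mod N) (G Mod N)"
  proof (rule homI)
    fix C assume "C \<in> carrier (G Mod N)"
    then show "induced_quotient_map G N \<phi> C \<in> carrier (G Mod N)"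
      by (auto simp: FactGroup_def RCOSETS_def coset intro: closed)
  next
    fix C D assume "C \<in> carrier (G Mod N)" "D \<in> carrier (G Mod N)"
    then show "induced_quotient_map G N \<phi> (C \<otimes>\<^bsub>G Mod N\<^esub> D)
        = induced_quotient_map G N \<phi> C \<otimes>\<^bsub>G Mod N\<^esub> induced_quotient_map G N \<phi> D"
      by (auto simp: FactGroup_def RCOSETS_def coset N.rcos_sum closed hom_mult[OF endo])
  qed
  then show ?thesis
    using N.factorgroup_is_group by (simp add: group_endomorphism_def group_endomorphism_axioms_def)
qed

text \<open>The projection to the quotient is a homomorphism that intertwines \<open>\<phi>\<close>
  with the induced map.\<close>

lemma trajectory_quotient:
  assumes "N \<lhd> G" "\<phi> ` N \<subseteq> N" "X \<subseteq> carrier G"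
  shows "trajectory (G Mod N) (induced_quotient_map G N \<phi>) ((\<lambda>x. N #> x) ` X) n
    = (\<lambda>x. N #> x) ` trajectory G \<phi> X n"
proof (induction n)
  case 0
  show ?case
    using coset_mult_one[OF normal_imp_subgroup[OF assms(1), THEN subgroup.subset]]
    by (simp add: FactGroup_def)
next
  case (Suc n)
  have "(induced_quotient_map G N \<phi> ^^ n) (N #> x) = N #> (\<phi> ^^ n) x" if "x \<in> carrier G" for x
    using that by (induction n) (auto simp: induced_quotient_map_coset[OF assms(1) endo assms(2)])
  then have "(induced_quotient_map G N \<phi> ^^ n) ` (\<lambda>x. N #> x) ` X = (\<lambda>x. N #> x) ` (\<phi> ^^ n) ` X"
    unfolding image_image using assms(3) by (intro image_cong) auto
  moreover have "(\<phi> ^^ n) ` X \<subseteq> carrier G" using assms(3) by auto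
  ultimately show ?case
    using Suc hom_image_set_mult[OF normal.r_coset_hom_Mod[OF assms(1)] trajectory_subset[OF assms(3)]]
    by simp
qed

lemma algebraic_entropy_quotient_finite:
  assumes N: "N \<lhd> G" "finite N" "\<phi> ` N \<subseteq> N"
  shows "algebraic_entropy (G Mod N) (induced_quotient_map G N \<phi>) = algebraic_entropy G \<phi>"
proof (rule antisym)
  interpret N: normal N G by (rule N)
  let ?\<pi> = "\<lambda>x. N #> x"
  let ?\<psi> = "induced_quotient_map G N \<phi>"
  note ends = group_endomorphism_axioms group_endomorphism_quotient[OF N(1,3)]
  have \<pi>: "?\<pi> ` X \<subseteq> carrier (G Mod N)" if "X \<subseteq> carrier G" for X
    using that by (auto simp: FactGroup_def RCOSETS_def)
  show "algebraic_entropy (G Mod N) ?\<psi> \<le> algebraic_entropy G \<phi>"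
  proof (rule algebraic_entropy_leI)
    fix Y assume Y: "Y \<subseteq> carrier (G Mod N)" "finite Y" "Y \<noteq> {}"
    \<comment> \<open>A finite set of cosets lifts to a finite set of representatives, and
      projecting its trajectories cannot enlarge them.\<close>
    then have "Y \<subseteq> ?\<pi> ` carrier G"
      by (auto simp: FactGroup_def RCOSETS_def)
    then obtain X where X: "X \<subseteq> carrier G" "finite X" "Y = ?\<pi> ` X"
      using finite_subset_image[OF Y(2)] by metis
    moreover have "X \<noteq> {}" using X Y by auto
    moreover have "entropy_wrt (G Mod N) ?\<psi> Y \<le> entropy_wrt G \<phi> X"
    proof (rule entropy_wrt_le[OF ends(2) Y ends(1)])
      show "card (trajectory (G Mod N) ?\<psi> Y (0 + n)) \<le> 1 * card (trajectory G \<phi> X (0 + n))" for n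
        by (simp add: X trajectory_quotient[OF N(1,3)] card_image_le trajectory_finite)
    qed (use X \<open>X \<noteq> {}\<close> in auto)
    ultimately show "\<exists>X\<subseteq>carrier G. finite X \<and> X \<noteq> {} \<and>
        entropy_wrt (G Mod N) ?\<psi> Y \<le> entropy_wrt G \<phi> X" by blast
  qed
  show "algebraic_entropy G \<phi> \<le> algebraic_entropy (G Mod N) ?\<psi>"
  proof (rule algebraic_entropy_leI)
    fix X assume X: "X \<subseteq> carrier G" "finite X" "X \<noteq> {}"
    have "entropy_wrt G \<phi> X \<le> entropy_wrt (G Mod N) ?\<psi> (?\<pi> ` X)"
    proof (rule entropy_wrt_le[OF ends(1) X ends(2)])
      fix n
      let ?T = "trajectory G \<phi> X n"
      have T: "?T \<subseteq> carrier G" "finite ?T"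
        using trajectory_subset trajectory_finite X by auto
      \<comment> \<open>The trajectory is covered by the cosets it meets, each of size
        \<open>card N\<close>.\<close>
      have "?T \<subseteq> \<Union> (?\<pi> ` ?T)"
        using rcos_self[OF _ N.subgroup_axioms] T(1) by blast
      moreover have fiber: "finite (?\<pi> x) \<and> card (?\<pi> x) = card N" if "x \<in> ?T" for x
      proof -
        have "?\<pi> x \<in> rcosets N"
          using that T(1) by (intro rcosetsI[OF N.subset]) auto
        then show ?thesis
          using rcosets_finite[OF _ N.subset N(2)] card_rcosets_equal[OF _ N.subset] by metis
      qed
      ultimately have "card ?T \<le> card (\<Union> (?\<pi> ` ?T))"
        using T(2) by (intro card_mono) auto
      also have "\<dots> \<le> (\<Sum>C\<in>?\<pi> ` ?T. card C)"
        by (rule card_Union_le_sum_card)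
      also have "\<dots> \<le> card (?\<pi> ` ?T) * card N"
        using fiber sum_bounded_above[of "?\<pi> ` ?T" card "card N"] by fastforce
      finally have "card ?T \<le> card (?\<pi> ` ?T) * card N" .
      then show "card (trajectory G \<phi> X (0 + n))
          \<le> card N * card (trajectory (G Mod N) ?\<psi> (?\<pi> ` X) (0 + n))"
        by (simp add: trajectory_quotient[OF N(1,3) X(1)] mult.commute)
    qed (use X \<pi> in auto)
    then show "\<exists>Y\<subseteq>carrier (G Mod N). finite Y \<and> Y \<noteq> {} \<and>
        entropy_wrt G \<phi> X \<le> entropy_wrt (G Mod N) ?\<psi> Y"
      using X \<pi> by (intro exI[of _ "?\<pi> ` X"]) auto
  qed
qed

end

section \<open>Subgroups that contain, or meet trivially, a subgroup of finite index\<close>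

context group
begin

text \<open>Because \<open>N <#> H = N\<close>, multiplying by \<open>N\<close> maps the cosets of
  \<open>H\<close> onto those of \<open>N\<close>.\<close>

lemma finite_index_supergroup:
  assumes "subgroup H G" "subgroup N G" "H \<subseteq> N" "finite_index H G"
  shows "finite_index N G"
proof -
  have "N #> x = N <#> (H #> x)" if "x \<in> carrier G" for x
  proof -
    have "N <#> H = N"
    proof
      show "N <#> H \<subseteq> N"
        using mono_set_mult[OF order_refl assms(3), of G N] subgroup_mult_id[OF assms(2)] by simp
      show "N \<subseteq> N <#> H"
      proof
        fix y assume y: "y \<in> N"
        then have "y = y \<otimes> \<one>"
          using subgroup.mem_carrier[OF assms(2)] by simp
        with y subgroup.one_closed[OF assms(1)] show "y \<in> N <#> H"
          unfolding set_mult_def by blast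
      qed
    qed
    then show ?thesis
      using setmult_rcos_assoc[of N H x] that assms(1,2) by (simp add: subgroup.subset)
  qed
  then have "rcosets N \<subseteq> (\<lambda>C. N <#> C) ` (rcosets H)"
    by (auto simp: RCOSETS_def)
  then show ?thesis
    using assms(4) by (auto simp: finite_index_def intro: finite_subset)
qed

text \<open>Two elements of \<open>N\<close> in one coset of \<open>H\<close> differ by an element
  of \<open>H \<inter> N\<close>, so \<open>N\<close> injects into the cosets of
  \<open>H\<close>.\<close>

lemma finite_subgroup_of_trivial_inter:
  assumes "subgroup H G" "subgroup N G" "H \<inter> N = {\<one>}" "finite_index H G"
  shows "finite N"
proof (rule finite_imageD)
  have "(\<lambda>x. H #> x) ` N \<subseteq> rcosets H"
    using subgroup.subset[OF assms(2)] by (auto simp: RCOSETS_def)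
  then show "finite ((\<lambda>x. H #> x) ` N)"
    using assms(4) by (auto simp: finite_index_def intro: finite_subset)
  show "inj_on (\<lambda>x. H #> x) N"
  proof (rule inj_onI)
    fix x y assume xy: "x \<in> N" "y \<in> N" "H #> x = H #> y"
    then have carr: "x \<in> carrier G" "y \<in> carrier G"
      using subgroup.subset[OF assms(2)] by auto
    have "x \<in> H #> y"
      using rcos_self[OF carr(1) assms(1)] xy(3) by simp
    then obtain h where h: "h \<in> H" "x = h \<otimes> y" by (auto simp: r_coset_def)
    moreover have "h \<in> carrier G" using h(1) subgroup.subset[OF assms(1)] by blast
    ultimately have "h = x \<otimes> inv y" using carr by (simp add: m_assoc)
    then have "h \<in> N"
      using xy subgroup.m_closed[OF assms(2)] subgroup.m_inv_closed[OF assms(2)] by blast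
    with h(1) assms(3) have "h = \<one>" by blast
    with h(2) carr(2) show "x = y" by simp
  qed
qed

end

section \<open>The addition theorem\<close>

theorem corollary5p3:
  fixes G :: "('a, 'b) monoid_scheme" and H :: "'a set"
  assumes "locally_finite_group G"
    and "fully_characteristic H G"
    and "finite_index H G"
    and "simple_grp (G\<lparr>carrier := H\<rparr>)"
  shows "addition_theorem G"
  unfolding addition_theorem_def
proof (intro ballI allI impI)
  interpret group G using assms(1) by (simp add: locally_finite_group_def)
  fix \<phi> N assume \<phi>: "\<phi> \<in> hom G G" and "N \<lhd> G \<and> \<phi> ` N \<subseteq> N"
  then have N: "N \<lhd> G" "\<phi> ` N \<subseteq> N" by auto
  interpret group_endomorphism G \<phi> by unfold_locales (rule \<phi>)
  interpret NG: group_endomorphism "G Mod N" "induced_quotient_map G N \<phi>"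
    by (rule group_endomorphism_quotient[OF N])
  have H: "subgroup H G" using assms(2) by (simp add: fully_characteristic_def)
  have N': "subgroup N G" by (rule normal_imp_subgroup[OF N(1)])
  interpret NN: group_endomorphism "G\<lparr>carrier := N\<rparr>" "restrict \<phi> N"
    by (rule group_endomorphism_restrict[OF N' N(2)])
  have "N \<inter> H \<lhd> G\<lparr>carrier := H\<rparr>"
    using normal_Int_subgroup[OF H N(1)] .
  then consider "N \<inter> H = H" | "N \<inter> H = {\<one>\<^bsub>G\<^esub>}"
    using assms(4) unfolding simple_grp_def by fastforce
  then show "algebraic_entropy G \<phi> = algebraic_entropy (G\<lparr>carrier := N\<rparr>) (restrict \<phi> N) +
      algebraic_entropy (G Mod N) (induced_quotient_map G N \<phi>)"
  proof cases
    \<comment> \<open>The quotient is finite and has entropy 0, so the restriction to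
      \<open>N\<close> must account for all the entropy.\<close>
    case 1
    then have "H \<subseteq> N" by blast
    then have "finite_index N G"
      using finite_index_supergroup[OF H N'] assms(3) by simp
    then have "finite (carrier (G Mod N))"
      by (simp add: finite_index_def FactGroup_def)
    then show ?thesis
      using algebraic_entropy_finite_index[OF N' \<open>finite_index N G\<close> N(2)]
        NG.algebraic_entropy_finite by simp
  next
    \<comment> \<open>Now the restriction to the finite \<open>N\<close> has entropy 0, and the
      quotient keeps all the entropy.\<close>
    case 2
    then have "finite N"
      using finite_subgroup_of_trivial_inter[OF H N'] assms(3) by (simp add: Int_commute)
    then show ?thesis
      using algebraic_entropy_quotient_finite[OF N(1) _ N(2)] NN.algebraic_entropy_finite by simp
  qed
qed

end
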